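(* Let $J_0$ be the $38$-vertex graph consisting of four pairwise disjoint cliques $C_1,C_2,C_3,C_4\cong K_9$ and two further vertices $u,v$, where consecutive cliques $C_i,C_{i+1}$ ($1\le i\le 3$) are joined completely, there are no edges between nonconsecutive cliques, $u$ is adjacent to exactly the vertices of $C_1$, and $v$ is adjacent to exactly the vertices of $C_4$ (so $uv$ is not an edge). Let $J_1=J_0+uv$. Then \[ \mathcal E_4^+(J_1)-\mathcal E_4^+(J_0)<-\frac{1281106782111}{500000000000}<0 . \]
   Context: For a finite simple graph $G$ with adjacency eigenvalues $\lambda_i(G)$ (the eigenvalues of its adjacency matrix, counted with multiplicity), the positive $4$-energy is \[ \mathcal E_4^+(G)=\sum_{\lambda_i(G)>0}\lambda_i(G)^4 . \] $J_0+uv$ denotes the graph obtained from $J_0$ by adding the edge $uv$. *)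

theory Defs
  imports Complex_Main "Jordan_Normal_Form.Char_Poly"
begin

text \<open>A finite graph is a pair \<open>(n, E)\<close> of its number of vertices and its edge set;
  the vertices are labelled \<open>0, \<dots>, n - 1\<close>.\<close>

type_synonym fin_graph = "nat \<times> nat set set"

definition simple_graph :: "fin_graph \<Rightarrow> bool" where
  "simple_graph G \<longleftrightarrow> (\<forall>e\<in>snd G. e \<subseteq> {0..<fst G} \<and> card e = 2)"

definition adj_matrix :: "fin_graph \<Rightarrow> real mat" where
  "adj_matrix G = mat (fst G) (fst G) (\<lambda>(i, j). if {i, j} \<in> snd G then 1 else 0)"

text \<open>The adjacency matrix is real symmetric, so all its eigenvalues are real; each one is
  counted with its multiplicity as a root of the characteristic polynomial.\<close>

definition pos_four_energy :: "fin_graph \<Rightarrow> real" where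
  "pos_four_energy G =
     (\<Sum>x | eigenvalue (adj_matrix G) x \<and> x > 0.
        real (order x (char_poly (adj_matrix G))) * x ^ 4)"

definition add_edge :: "fin_graph \<Rightarrow> nat \<Rightarrow> nat \<Rightarrow> fin_graph" where
  "add_edge G a b = (fst G, insert {a, b} (snd G))"

definition clique_verts :: "nat \<Rightarrow> nat set" where
  "clique_verts i = {9 * (i - 1)..<9 * i}"

definition vertex_u :: nat where "vertex_u = 36"

definition vertex_v :: nat where "vertex_v = 37"

definition J0 :: fin_graph where
  "J0 = (38,
     {{x, y} | x y i. i \<in> {1..4} \<and> x \<in> clique_verts i \<and> y \<in> clique_verts i \<and> x \<noteq> y}
   \<union> {{x, y} | x y i. i \<in> {1..3} \<and> x \<in> clique_verts i \<and> y \<in> clique_verts (i + 1)}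
   \<union> {{vertex_u, x} | x. x \<in> clique_verts 1}
   \<union> {{vertex_v, x} | x. x \<in> clique_verts 4})"

definition J1 :: fin_graph where
  "J1 = add_edge J0 vertex_u vertex_v"

lemma simple_graph_J0: "simple_graph J0"
  unfolding simple_graph_def J0_def clique_verts_def vertex_u_def vertex_v_def
  by (auto simp: card_insert_if)

lemma uv_notin_J0: "{vertex_u, vertex_v} \<notin> snd J0"
  unfolding J0_def clique_verts_def vertex_u_def vertex_v_def
  by (auto simp: doubleton_eq_iff)

lemma simple_graph_J1: "simple_graph J1"
  using simple_graph_J0
  by (auto simp: simple_graph_def J1_def add_edge_def J0_def vertex_u_def vertex_v_def)

end

theory Submission
  imports Defs
begin

text \<open>In \<open>A + I\<close> the rows of closed twins coincide, so \<open>A + I = S R\<close> factors through the six twin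
  classes \<open>u, C\<^sub>1, \<dots>, C\<^sub>4, v\<close>, and Sylvester's identity
  \<open>y\<^sup>k det (y I - S R) = y\<^sup>n det (y I - R S)\<close> leaves a weighted \<open>6 \<times> 6\<close> determinant. Reversal
  of the path of classes splits it into two cubics. For \<open>J\<^sub>1\<close> both cubics are divisible by
  \<open>x + 1\<close>, the positive eigenvalues are \<open>14\<close> and \<open>(27 \<plusminus> sqrt 337) / 2\<close>, all simple, and the energy is
  exactly \<open>303297\<close>. For \<open>J\<^sub>0\<close> sign changes of the cubics give three positive eigenvalues whose
  fourth powers already exceed \<open>303300\<close>.\<close>

section \<open>Sylvester's determinant identity\<close>

lemma det_scalar_minus_mult_swap:
  fixes S R :: "'a :: idom mat"
  assumes S: "S \<in> carrier_mat n k" and R: "R \<in> carrier_mat k n"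
  shows "y ^ k * det (y \<cdot>\<^sub>m 1\<^sub>m n - S * R) = y ^ n * det (y \<cdot>\<^sub>m 1\<^sub>m k - R * S)"
proof -
  define M where "M = four_block_mat (y \<cdot>\<^sub>m 1\<^sub>m n) S R (1\<^sub>m k)"
  have M: "M \<in> carrier_mat (n + k) (n + k)"
    unfolding M_def using S R by auto
  \<comment> \<open>Multiplying \<open>M\<close> by \<open>L\<close> on the right or by
    \<open>U\<close> on the left clears its lower left block, so \<open>det M\<close> is computed in
    two ways. The block y I in \<open>U\<close> scales the lower rows of \<open>M\<close>, which
    avoids inverting y.\<close>
  define L where "L = four_block_mat (1\<^sub>m n) (0\<^sub>m n k) (- R) (1\<^sub>m k)"
  define U where "U = four_block_mat (1\<^sub>m n) (0\<^sub>m n k) (- R) (y \<cdot>\<^sub>m 1\<^sub>m k)"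
  have L: "L \<in> carrier_mat (n + k) (n + k)" and U: "U \<in> carrier_mat (n + k) (n + k)"
    unfolding L_def U_def using R by auto
  have mL: "M * L = four_block_mat (y \<cdot>\<^sub>m 1\<^sub>m n - S * R) S (0\<^sub>m k n) (1\<^sub>m k)"
    unfolding M_def L_def
    by (subst mult_four_block_mat[of _ n n _ k _ k _ _ n _ k])
      (use S R in \<open>auto intro!: arg_cong4[where f = four_block_mat] eq_matI\<close>)
  have uM: "U * M = four_block_mat (y \<cdot>\<^sub>m 1\<^sub>m n) S (0\<^sub>m k n) (y \<cdot>\<^sub>m 1\<^sub>m k - R * S)"
    unfolding M_def U_def
    by (subst mult_four_block_mat[of _ n n _ k _ k _ _ n _ k])
      (use S R in \<open>auto intro!: arg_cong4[where f = four_block_mat] eq_matI\<close>)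
  have dL: "det L = 1"
    unfolding L_def using R by (subst det_four_block_mat_upper_right_zero[of _ n _ k]) auto
  have dU: "det U = y ^ k"
    unfolding U_def using R by (subst det_four_block_mat_upper_right_zero[of _ n _ k]) (auto simp: det_smult)
  have "det M = det (M * L)"
    using det_mult[OF M L] dL by simp
  also have "\<dots> = det (y \<cdot>\<^sub>m 1\<^sub>m n - S * R)"
    unfolding mL using S R by (subst det_four_block_mat_lower_left_zero[of _ n _ k]) auto
  finally have 1: "det M = det (y \<cdot>\<^sub>m 1\<^sub>m n - S * R)" .
  have "y ^ k * det M = det (U * M)"
    using det_mult[OF U M] dU by simp
  also have "\<dots> = y ^ n * det (y \<cdot>\<^sub>m 1\<^sub>m k - R * S)"
    unfolding uM using S R by (subst det_four_block_mat_lower_left_zero[of _ n _ k]) (auto simp: det_smult)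
  finally show ?thesis using 1 by simp
qed

section \<open>Laplace expansion of explicit determinants\<close>

lemma det_mat_Suc:
  fixes f :: "nat \<Rightarrow> nat \<Rightarrow> 'a :: comm_ring_1"
  shows "det (mat (Suc n) (Suc n) (\<lambda>(i, j). f i j)) =
    (\<Sum>i<Suc n. f i 0 * (-1) ^ i * det (mat n n (\<lambda>(a, b). f (if a < i then a else Suc a) (Suc b))))"
proof -
  have "det (mat (Suc n) (Suc n) (\<lambda>(i, j). f i j)) =
    (\<Sum>i<Suc n. mat (Suc n) (Suc n) (\<lambda>(i, j). f i j) $$ (i, 0) * cofactor (mat (Suc n) (Suc n) (\<lambda>(i, j). f i j)) i 0)"
    by (rule laplace_expansion_column) auto
  also have "\<dots> = (\<Sum>i<Suc n. f i 0 * (-1) ^ i * det (mat n n (\<lambda>(a, b). f (if a < i then a else Suc a) (Suc b))))"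
  proof (intro sum.cong refl)
    fix i assume "i \<in> {..<Suc n}"
    moreover have "mat_delete (mat (Suc n) (Suc n) (\<lambda>(i, j). f i j)) i 0 =
        mat n n (\<lambda>(a, b). f (if a < i then a else Suc a) (Suc b))"
      by (rule eq_matI) (auto simp: mat_delete_def)
    ultimately show "mat (Suc n) (Suc n) (\<lambda>(i, j). f i j) $$ (i, 0) * cofactor (mat (Suc n) (Suc n) (\<lambda>(i, j). f i j)) i 0 =
        f i 0 * (-1) ^ i * det (mat n n (\<lambda>(a, b). f (if a < i then a else Suc a) (Suc b)))"
      by (simp add: cofactor_def)
  qed
  finally show ?thesis .
qed

text \<open>Rows are lists so that minors can be computed by rewriting: \<open>tl\<close> deletes
  the first column, \<open>take\<close> and \<open>drop\<close> delete a row.\<close>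

definition det_rows :: "nat \<Rightarrow> 'a :: comm_ring_1 list list \<Rightarrow> 'a" where
  "det_rows n rs = det (mat n n (\<lambda>(i, j). rs ! i ! j))"

lemma det_rows_Suc:
  assumes "length rs = Suc n" and "\<forall>r\<in>set rs. r \<noteq> []"
  shows "det_rows (Suc n) rs =
    (\<Sum>i<Suc n. (-1) ^ i * hd (rs ! i) * det_rows n (map tl (take i rs @ drop (Suc i) rs)))"
proof -
  have "r ! Suc j = tl r ! j" if "r \<in> set rs" for r j
  proof -
    have "r \<noteq> []" using that assms(2) by blast
    then show ?thesis by (cases r) auto
  qed
  then have "mat n n (\<lambda>(a, b). rs ! (if a < i then a else Suc a) ! Suc b) =
      mat n n (\<lambda>(a, b). map tl (take i rs @ drop (Suc i) rs) ! a ! b)" if "i < Suc n" for i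
    using that assms(1) by (intro eq_matI) (auto simp: nth_append min_def)
  moreover have "rs ! i ! 0 = hd (rs ! i)" if "i < Suc n" for i
    using that assms by (simp add: hd_conv_nth)
  ultimately show ?thesis
    unfolding det_rows_def det_mat_Suc by (intro sum.cong) (simp_all add: mult_ac)
qed

lemma det_rows_2: "det_rows 2 [[a, b], [c, d]] = a * d - b * c"
  by (simp add: det_rows_def det_mat_Suc numeral_2_eq_2 lessThan_Suc)

section \<open>Twin classes and the quotient determinant\<close>

text \<open>The classes \<open>u, C\<^sub>1, \<dots>, C\<^sub>4, v\<close> are numbered \<open>0, \<dots>, 5\<close>, so that adjacency of classes is
  that of a path, with loops; the flag \<open>t\<close> says whether the edge \<open>uv\<close> is present.\<close>

definition cls :: "nat \<Rightarrow> nat" where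
  "cls i = (if i < 36 then i div 9 + 1 else if i = 36 then 0 else 5)"

definition cls_size :: "nat \<Rightarrow> nat" where
  "cls_size a = (if a = 0 \<or> a = 5 then 1 else 9)"

definition adj_quot :: "bool \<Rightarrow> nat \<Rightarrow> nat \<Rightarrow> bool" where
  "adj_quot t a b \<longleftrightarrow> a \<le> Suc b \<and> b \<le> Suc a \<or> t \<and> (a = 0 \<and> b = 5 \<or> a = 5 \<and> b = 0)"

text \<open>Characteristic polynomial of the class quotient on vectors fixed by the reversal of the
  path of classes; \<open>odd_cubic\<close> is the one on vectors negated by it. The parameter
  \<open>t\<close> is the weight of the edge between the end classes. The two middle classes
  contribute 8 + 9 = 17 in the even case and 8 - 9 = -1 in the odd case.\<close>

definition even_cubic :: "real \<Rightarrow> real \<Rightarrow> real" where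
  "even_cubic t x = (x - t) * ((x - 8) * (x - 17) - 81) - 9 * (x - 17)"

definition odd_cubic :: "real \<Rightarrow> real \<Rightarrow> real" where
  "odd_cubic t x = (x + t) * ((x - 8) * (x + 1) - 81) - 9 * (x + 1)"

text \<open>The loops of \<open>adj_quot\<close> make this the quotient of A + I, hence the shift to
  \<open>x - 1\<close>.\<close>

lemma det_quot:
  "det (x \<cdot>\<^sub>m 1\<^sub>m 6 - mat 6 6 (\<lambda>(a, b). of_bool (adj_quot t a b) * real (cls_size b))) =
    even_cubic (of_bool t) (x - 1) * odd_cubic (of_bool t) (x - 1)"
proof -
  \<comment> \<open>Reversal symmetry holds for any weight of the closing edge, so one expansion
    with symbolic \<open>\<tau>\<close> covers both graphs.\<close>
  define \<tau> :: real where "\<tau> = of_bool t"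
  define rs where "rs =
    [[x - 1, - 9, 0, 0, 0, - \<tau>],
     [- 1, x - 9, - 9, 0, 0, 0],
     [0, - 9, x - 9, - 9, 0, 0],
     [0, 0, - 9, x - 9, - 9, 0],
     [0, 0, 0, - 9, x - 9, - 1],
     [- \<tau>, 0, 0, 0, - 9, x - 1]]"
  have ent: "(x \<cdot>\<^sub>m 1\<^sub>m 6 - mat 6 6 (\<lambda>(a, b). of_bool (adj_quot t a b) * real (cls_size b))) $$ (a, b) = rs ! a ! b"
    if "a < 6" "b < 6" for a b
  proof -
    have "a \<in> {0, 1, 2, 3, 4, 5}" and "b \<in> {0, 1, 2, 3, 4, 5}"
      using that by auto
    then show ?thesis
      by (auto simp: adj_quot_def cls_size_def rs_def \<tau>_def)
  qed
  have "x \<cdot>\<^sub>m 1\<^sub>m 6 - mat 6 6 (\<lambda>(a, b). of_bool (adj_quot t a b) * real (cls_size b)) =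
    mat 6 6 (\<lambda>(i, j). rs ! i ! j)"
    by (rule eq_matI) (simp_all only: dim_row_mat dim_col_mat index_mat index_minus_mat(2,3) ent split)
  then have "det (x \<cdot>\<^sub>m 1\<^sub>m 6 - mat 6 6 (\<lambda>(a, b). of_bool (adj_quot t a b) * real (cls_size b))) = det_rows 6 rs"
    by (simp add: det_rows_def)
  also have "\<dots> = even_cubic \<tau> (x - 1) * odd_cubic \<tau> (x - 1)"
    unfolding rs_def
    \<comment> \<open>One column per simplifier call: zero entries kill their minors before these are expanded.\<close>
    by (simp add: det_rows_Suc[where n = 5, simplified] lessThan_Suc lessThan_nat_numeral,
        simp add: det_rows_Suc[where n = 4, simplified] lessThan_Suc lessThan_nat_numeral,
        simp add: det_rows_Suc[where n = 3, simplified] lessThan_Suc lessThan_nat_numeral,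
        simp add: det_rows_Suc[where n = 2, simplified] lessThan_Suc lessThan_nat_numeral,
        simp add: det_rows_2 even_cubic_def odd_cubic_def algebra_simps)
  finally show ?thesis unfolding \<tau>_def .
qed

section \<open>Adjacency in terms of twin classes\<close>

definition adj_graph :: "bool \<Rightarrow> fin_graph" where
  "adj_graph t = (if t then J1 else J0)"

lemma cls_less: "i < 38 \<Longrightarrow> cls i < 6"
  by (auto simp: cls_def)

lemma mem_clique_verts_iff:
  "i < 38 \<Longrightarrow> k \<in> {1..4} \<Longrightarrow> i \<in> clique_verts k \<longleftrightarrow> cls i = k"
  by (auto simp: clique_verts_def cls_def)

text \<open>In its use, \<open>e\<close> says that the two vertices are equal. The last hypothesis
  then expresses that the end classes are singletons, so that their loops yield no edge.\<close>

lemma path_adj_iff: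
  fixes a b :: nat
  assumes "a < 6" "b < 6" "e \<Longrightarrow> a = b" "a = b \<Longrightarrow> \<not> e \<Longrightarrow> a \<noteq> 0 \<and> a \<noteq> 5"
  shows "(1 \<le> a \<and> a \<le> 4 \<and> a = b \<and> \<not> e) \<or>
      (1 \<le> a \<and> a \<le> 3 \<and> b = a + 1 \<or> 1 \<le> b \<and> b \<le> 3 \<and> a = b + 1) \<or>
      a = 0 \<and> b = 1 \<or> b = 0 \<and> a = 1 \<or> a = 5 \<and> b = 4 \<or> b = 5 \<and> a = 4 \<longleftrightarrow>
    \<not> e \<and> a \<le> Suc b \<and> b \<le> Suc a"
proof (cases e)
  case True
  then show ?thesis using assms by auto
next
  case False
  have "a \<in> {0, 1, 2, 3, 4, 5}" "b \<in> {0, 1, 2, 3, 4, 5}"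
    using assms(1,2) by auto
  then show ?thesis using False assms(4) by (elim insertE emptyE; simp)
qed

lemma mem_J0_iff:
  assumes "i < 38" "j < 38"
  shows "{i, j} \<in> snd J0 \<longleftrightarrow> i \<noteq> j \<and> adj_quot False (cls i) (cls j)"
proof -
  have u: "i = vertex_u \<longleftrightarrow> cls i = 0" and v: "i = vertex_v \<longleftrightarrow> cls i = 5" if "i < 38" for i
    using that by (auto simp: cls_def vertex_u_def vertex_v_def)
  have "{i, j} \<in> snd J0 \<longleftrightarrow>
      (\<exists>k\<in>{1..4}. i \<in> clique_verts k \<and> j \<in> clique_verts k \<and> i \<noteq> j) \<or>
      (\<exists>k\<in>{1..3}. i \<in> clique_verts k \<and> j \<in> clique_verts (k + 1) \<or>
                j \<in> clique_verts k \<and> i \<in> clique_verts (k + 1)) \<or>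
      i = vertex_u \<and> j \<in> clique_verts 1 \<or> j = vertex_u \<and> i \<in> clique_verts 1 \<or>
      i = vertex_v \<and> j \<in> clique_verts 4 \<or> j = vertex_v \<and> i \<in> clique_verts 4"
  proof -
    have 1: "{i, j} \<in> {{x, y} | x y k. k \<in> K \<and> x \<in> C k \<and> y \<in> C k \<and> x \<noteq> y} \<longleftrightarrow>
        (\<exists>k\<in>K. i \<in> C k \<and> j \<in> C k \<and> i \<noteq> j)" for K and C :: "nat \<Rightarrow> nat set"
      by (auto simp: doubleton_eq_iff)
    have 2: "{i, j} \<in> {{x, y} | x y k. k \<in> K \<and> x \<in> C k \<and> y \<in> D k} \<longleftrightarrow>
        (\<exists>k\<in>K. i \<in> C k \<and> j \<in> D k \<or> j \<in> C k \<and> i \<in> D k)" for K and C D :: "nat \<Rightarrow> nat set"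
      by (auto simp: doubleton_eq_iff)
    have 3: "{i, j} \<in> {{w, x} | x. x \<in> C} \<longleftrightarrow> i = w \<and> j \<in> C \<or> j = w \<and> i \<in> C" for w and C :: "nat set"
      by (auto simp: doubleton_eq_iff)
    show ?thesis
      unfolding J0_def snd_conv Un_iff 1 2 3 by (simp only: disj_assoc)
  qed
  also have "\<dots> \<longleftrightarrow>
      (\<exists>k\<in>{1..4}. cls i = k \<and> cls j = k \<and> i \<noteq> j) \<or>
      (\<exists>k\<in>{1..3}. cls i = k \<and> cls j = k + 1 \<or> cls j = k \<and> cls i = k + 1) \<or>
      cls i = 0 \<and> cls j = 1 \<or> cls j = 0 \<and> cls i = 1 \<or>
      cls i = 5 \<and> cls j = 4 \<or> cls j = 5 \<and> cls i = 4"
    using assms by (simp add: mem_clique_verts_iff u v)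
  also have "\<dots> \<longleftrightarrow> i \<noteq> j \<and> adj_quot False (cls i) (cls j)"
  proof -
    have same: "cls i \<noteq> 0 \<and> cls i \<noteq> 5" if "cls i = cls j" "i \<noteq> j"
      using that assms u[of i] u[of j] v[of i] v[of j] by auto
    have eq1: "(\<exists>k\<in>{1..4}. cls i = k \<and> cls j = k \<and> i \<noteq> j) \<longleftrightarrow>
        1 \<le> cls i \<and> cls i \<le> 4 \<and> cls i = cls j \<and> i \<noteq> j"
      by auto
    have eq2: "(\<exists>k\<in>{1..3}. cls i = k \<and> cls j = k + 1 \<or> cls j = k \<and> cls i = k + 1) \<longleftrightarrow>
        1 \<le> cls i \<and> cls i \<le> 3 \<and> cls j = cls i + 1 \<or> 1 \<le> cls j \<and> cls j \<le> 3 \<and> cls i = cls j + 1"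
      by auto
    show ?thesis
      unfolding eq1 eq2 adj_quot_def simp_thms
      by (rule path_adj_iff[OF cls_less[OF assms(1)] cls_less[OF assms(2)]]) (simp, rule same)
  qed
  finally show ?thesis .
qed

lemma adj_matrix_adj_graph:
  "adj_matrix (adj_graph t) =
    mat 38 38 (\<lambda>(i, j). of_bool (i \<noteq> j \<and> adj_quot t (cls i) (cls j)))"
proof -
  have e: "{i, j} = {vertex_u, vertex_v} \<longleftrightarrow> cls i = 0 \<and> cls j = 5 \<or> cls i = 5 \<and> cls j = 0"
    if "i < 38" "j < 38" for i j
    using that by (auto simp: cls_def vertex_u_def vertex_v_def doubleton_eq_iff)
  have "fst J0 = 38" by (simp add: J0_def)
  then show ?thesis
    unfolding adj_matrix_def adj_graph_def J1_def add_edge_def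
    by (intro eq_matI) (auto simp: mem_J0_iff e adj_quot_def)
qed

lemma card_cls: "a < 6 \<Longrightarrow> card {i \<in> {0..<38}. cls i = a} = cls_size a"
proof -
  assume "a < 6"
  then consider "a = 0" | "a = 5" | "a \<in> {1..4}" by fastforce
  then show ?thesis
  proof cases
    case 1
    then have "{i \<in> {0..<38}. cls i = a} = {36}" by (auto simp: cls_def split: if_splits)
    then show ?thesis using 1 by (simp add: cls_size_def)
  next
    case 2
    then have "{i \<in> {0..<38}. cls i = a} = {37}" by (auto simp: cls_def split: if_splits)
    then show ?thesis using 2 by (simp add: cls_size_def)
  next
    case 3
    have "{i \<in> {0..<38}. cls i = a} = clique_verts a"
    proof -
      have "clique_verts a \<subseteq> {0..<38}" using 3 by (auto simp: clique_verts_def)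
      then show ?thesis using mem_clique_verts_iff[OF _ 3] by (auto 0 3)
    qed
    then show ?thesis using 3 by (auto simp: cls_size_def clique_verts_def diff_mult_distrib2)
  qed
qed

section \<open>Characteristic polynomials of the two graphs\<close>

lemma poly_char_poly_adj_graph:
  "(x + 1) ^ 6 * poly (char_poly (adj_matrix (adj_graph t))) x =
    (x + 1) ^ 38 * (even_cubic (of_bool t) x * odd_cubic (of_bool t) x)"
proof -
  define A where "A = adj_matrix (adj_graph t)"
  define S where "S = mat 38 6 (\<lambda>(i, a). of_bool (cls i = a) :: real)"
  define R where "R = mat 6 38 (\<lambda>(a, i). of_bool (adj_quot t a (cls i)) :: real)"
  have A: "A \<in> carrier_mat 38 38" and S: "S \<in> carrier_mat 38 6" and R: "R \<in> carrier_mat 6 38"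
    by (simp_all add: A_def S_def R_def adj_matrix_adj_graph)
  \<comment> \<open>The loops give \<open>S * R\<close> a unit diagonal, so it equals A + I, and x I
    - A = (x + 1) I - \<open>S * R\<close>.\<close>
  have refl: "adj_quot t a a" for a
    by (simp add: adj_quot_def)
  have "(S * R) $$ (i, j) = of_bool (adj_quot t (cls i) (cls j))" if "i < 38" "j < 38" for i j
  proof -
    have "(S * R) $$ (i, j) =
        (\<Sum>a\<in>{0..<6}. of_bool (cls i = a) * of_bool (adj_quot t a (cls j)))"
      using that by (simp add: S_def R_def scalar_prod_def)
    also have "\<dots> = (\<Sum>a\<in>{0..<6}. if a = cls i then of_bool (adj_quot t (cls i) (cls j)) else 0)"
      by (intro sum.cong) auto
    also have "\<dots> = of_bool (adj_quot t (cls i) (cls j))"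
      using cls_less that by simp
    finally show ?thesis .
  qed
  then have "- char_matrix A x = (x + 1) \<cdot>\<^sub>m 1\<^sub>m 38 - S * R"
    using S R unfolding char_matrix_def A_def adj_matrix_adj_graph
    by (intro eq_matI) (auto simp: refl)
  then have 1: "poly (char_poly A) x = det ((x + 1) \<cdot>\<^sub>m 1\<^sub>m 38 - S * R)"
    using char_poly_matrix[OF A] by simp
  have "(R * S) $$ (a, b) = of_bool (adj_quot t a b) * real (cls_size b)" if "a < 6" "b < 6" for a b
  proof -
    have "(R * S) $$ (a, b) =
        (\<Sum>i\<in>{0..<38}. of_bool (adj_quot t a (cls i)) * of_bool (cls i = b))"
      using that by (simp add: S_def R_def scalar_prod_def)
    also have "\<dots> = (\<Sum>i\<in>{0..<38}. if cls i = b then of_bool (adj_quot t a b) else 0)"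
      by (intro sum.cong) auto
    also have "\<dots> = of_bool (adj_quot t a b) * real (card {i \<in> {0..<38}. cls i = b})"
      by (simp only: sum.inter_filter[symmetric] finite_atLeastLessThan) simp
    finally show ?thesis
      using card_cls that by simp
  qed
  then have "R * S = mat 6 6 (\<lambda>(a, b). of_bool (adj_quot t a b) * real (cls_size b))"
    using S R by (intro eq_matI) auto
  then show ?thesis
    using det_scalar_minus_mult_swap[OF S R, of "x + 1"] det_quot[of "x + 1" t]
    unfolding 1[unfolded A_def] by simp
qed

text \<open>This pointwise form suffices for \<open>J0\<close>, where only positive roots have to be
  exhibited.\<close>

lemma poly_char_poly_J:
  fixes x :: real
  assumes "x \<noteq> - 1"
  shows "poly (char_poly (adj_matrix (adj_graph t))) x =
    (x + 1) ^ 32 * (even_cubic (of_bool t) x * odd_cubic (of_bool t) x)"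
proof -
  have "(x + 1) ^ 38 = (x + 1) ^ 6 * (x + 1) ^ 32"
    by (simp flip: power_add)
  moreover have "(x + 1) ^ 6 \<noteq> 0"
    using assms by (simp add: add_eq_0_iff2)
  ultimately show ?thesis
    using poly_char_poly_adj_graph[of x t] by (simp only: mult.assoc mult_cancel_left simp_thms)
qed

lemma poly_monic_linear: "poly [:c, 1:] x = x + c"
  for c :: "'a :: comm_semiring_1"
  by (simp add: add.commute)

text \<open>An exact energy needs root orders, hence an identity of polynomials. It is checked
  pointwise after multiplication by (x + 1)^6, so that x = -1 needs no exception, and the factor is
  then cancelled. The exponent 34 is 38 - 6 plus one factor from each cubic.\<close>

lemma char_poly_J1:
  "char_poly (adj_matrix J1) =
    [:1, 1:] ^ 34 * [:7, 1:] * [:- 14, 1:] * [:- ((27 + sqrt 337) / 2), 1:] * [:- ((27 - sqrt 337) / 2), 1:]"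
  (is "_ = ?F")
proof -
  have "poly ([:1, 1:] ^ 6 * char_poly (adj_matrix J1)) x = poly ([:1, 1:] ^ 6 * ?F) x" for x :: real
  proof -
    have even: "even_cubic 1 x = (x + 1) * ((x - (27 + sqrt 337) / 2) * (x - (27 - sqrt 337) / 2))"
      by (simp add: even_cubic_def field_simps)
    have odd: "odd_cubic 1 x = (x + 1) * ((x + 7) * (x - 14))"
      by (simp add: odd_cubic_def algebra_simps)
    have pow: "(x + 1) ^ 6 * (x + 1) ^ 34 = (x + 1) ^ 38 * ((x + 1) * (x + 1))"
      by (simp flip: power_add power2_eq_square)
    have "poly ([:1, 1:] ^ 6 * ?F) x = (x + 1) ^ 6 * (x + 1) ^ 34 *
        ((x + 7) * (x - 14) * ((x - (27 + sqrt 337) / 2) * (x - (27 - sqrt 337) / 2)))"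
      unfolding poly_mult poly_power poly_monic_linear diff_conv_add_uminus
      by (simp only: mult_ac)
    also have "\<dots> = (x + 1) ^ 38 * (even_cubic 1 x * odd_cubic 1 x)"
      unfolding even odd pow by (simp only: mult_ac)
    finally have "poly ([:1, 1:] ^ 6 * ?F) x = (x + 1) ^ 38 * (even_cubic 1 x * odd_cubic 1 x)" .
    then show ?thesis
      using poly_char_poly_adj_graph[of x True]
      by (simp only: adj_graph_def poly_mult poly_power poly_monic_linear of_bool_eq if_True)
  qed
  then have "[:1, 1:] ^ 6 * char_poly (adj_matrix J1) = [:1, 1:] ^ 6 * ?F"
    by (intro poly_eq_poly_eq_iff[THEN iffD1] ext)
  then show ?thesis by simp
qed

lemma order_simple_root:
  fixes q :: "'a :: idom poly"
  assumes "p = [:- c, 1:] * q" "poly q c \<noteq> 0"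
  shows "order c p = 1"
proof -
  have "q \<noteq> 0" using assms(2) by auto
  then have "order c p = order c [:- c, 1:] + order c q"
    unfolding assms(1) by (intro order_mult) (simp only: mult_eq_0_iff, simp)
  then show ?thesis
    using assms(2) by (simp add: order_0I)
qed

section \<open>Positive 4-energies\<close>

lemma adj_matrix_carrier: "adj_matrix G \<in> carrier_mat (fst G) (fst G)"
  by (simp add: adj_matrix_def)

lemma pos_four_energy_char_poly:
  "pos_four_energy G =
    (\<Sum>x | poly (char_poly (adj_matrix G)) x = 0 \<and> x > 0.
      real (order x (char_poly (adj_matrix G))) * x ^ 4)"
  by (simp add: pos_four_energy_def eigenvalue_root_char_poly[OF adj_matrix_carrier])

lemma pos_four_energy_J1: "pos_four_energy J1 = 303297"
proof -
  define s where "s = sqrt (337 :: real)"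
  define a where "a = (27 + s) / 2"
  define b where "b = (27 - s) / 2"
  define p where "p = char_poly (adj_matrix J1)"
  have ss: "s * s = 337" by (simp add: s_def)
  \<comment> \<open>These bounds make \<open>a\<close>, \<open>b\<close> and 14 distinct and
    positive, which gives simplicity of the three roots.\<close>
  have "18 < s" "s < 19"
    unfolding s_def by (auto intro: real_less_rsqrt real_less_lsqrt)
  then have ab: "22 < a" "4 < b" "b < 5" by (simp_all add: a_def b_def)
  have p: "p = [:1, 1:] ^ 34 * [:7, 1:] * [:- 14, 1:] * [:- a, 1:] * [:- b, 1:]"
    unfolding p_def char_poly_J1 a_def b_def s_def ..
  have "order 14 p = 1"
    by (rule order_simple_root[of _ _ "[:1, 1:] ^ 34 * [:7, 1:] * [:- a, 1:] * [:- b, 1:]"])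
      (simp_all only: p mult_ac poly_mult poly_power poly_monic_linear mult_eq_0_iff power_eq_0_iff,
        use ab in simp_all)
  moreover have "order a p = 1"
    by (rule order_simple_root[of _ _ "[:1, 1:] ^ 34 * [:7, 1:] * [:- 14, 1:] * [:- b, 1:]"])
      (simp_all only: p mult_ac poly_mult poly_power poly_monic_linear mult_eq_0_iff power_eq_0_iff,
        use ab in simp_all)
  moreover have "order b p = 1"
    by (rule order_simple_root[of _ _ "[:1, 1:] ^ 34 * [:7, 1:] * [:- 14, 1:] * [:- a, 1:]"])
      (simp_all only: p mult_ac poly_mult poly_power poly_monic_linear mult_eq_0_iff power_eq_0_iff,
        use ab in simp_all)
  moreover have "poly p x = 0 \<longleftrightarrow> x = - 1 \<or> x = - 7 \<or> x = 14 \<or> x = a \<or> x = b" for x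
    unfolding p poly_mult poly_power poly_monic_linear mult_eq_0_iff power_eq_0_iff by auto
  then have "{x. poly p x = 0 \<and> x > 0} = {14, a, b}"
    using ab by auto
  ultimately have "pos_four_energy J1 = 14 ^ 4 + (a ^ 4 + b ^ 4)"
    using ab by (simp add: pos_four_energy_char_poly flip: p_def)
  \<comment> \<open>The irrational parts cancel: the power sum is a polynomial in
    \<open>a + b\<close> and \<open>a * b\<close>.\<close>
  moreover have "a ^ 4 + b ^ 4 = 264881"
  proof -
    have "a + b = 27" by (simp add: a_def b_def field_simps)
    moreover have "a * b = 98" using ss by (simp add: a_def b_def field_simps)
    moreover have "a ^ 4 + b ^ 4 = ((a + b)\<^sup>2 - 2 * (a * b))\<^sup>2 - 2 * (a * b)\<^sup>2"
      by (simp add: power2_eq_square power4_eq_xxxx algebra_simps)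
    ultimately show ?thesis by simp
  qed
  ultimately show ?thesis by simp
qed

text \<open>Each root has order at least 1 and the omitted terms are nonnegative, so for a lower
  bound neither multiplicities nor the completeness of \<open>X\<close> matter.\<close>

lemma pos_four_energy_ge:
  assumes "fst G > 0" "finite X" "\<And>x. x \<in> X \<Longrightarrow> poly (char_poly (adj_matrix G)) x = 0 \<and> x > 0"
  shows "(\<Sum>x\<in>X. x ^ 4) \<le> pos_four_energy G"
proof -
  let ?p = "char_poly (adj_matrix G)"
  have p: "?p \<noteq> 0"
    using degree_monic_char_poly[OF adj_matrix_carrier[of G]] by auto
  have "(\<Sum>x\<in>X. x ^ 4) \<le> (\<Sum>x\<in>X. real (order x ?p) * x ^ 4)"
  proof (rule sum_mono)
    fix x assume "x \<in> X"
    then have "order x ?p \<noteq> 0"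
      using assms(3) p order_root by blast
    then have "1 \<le> real (order x ?p)" by simp
    then show "x ^ 4 \<le> real (order x ?p) * x ^ 4"
      using mult_right_mono[of 1 "real (order x ?p)" "x ^ 4"] by simp
  qed
  also have "\<dots> \<le> (\<Sum>x | poly ?p x = 0 \<and> x > 0. real (order x ?p) * x ^ 4)"
    using assms(3) by (intro sum_mono2 finite_subset[OF _ poly_roots_finite[OF p]]) auto
  finally show ?thesis
    unfolding pos_four_energy_char_poly .
qed

text \<open>The bound exceeds the energy 303297 of \<open>J1\<close> by 3, while the gap required is
  less than 2.57.\<close>

lemma pos_four_energy_J0: "303300 < pos_four_energy J0"
proof -
  have cont: "continuous_on A (even_cubic 0)" "continuous_on A (odd_cubic 0)" for A
    unfolding even_cubic_def odd_cubic_def by (intro continuous_intros)+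
  \<comment> \<open>The left endpoints are roots rounded down, closely enough that their fourth
    powers sum to more than 303300. At this root the cubic changes from positive to negative, hence
    \<open>IVT2'\<close>; at the other two the signs are reversed.\<close>
  have "\<exists>x\<ge>4.009. x \<le> 5 \<and> even_cubic 0 x = 0"
    by (rule IVT2') (simp_all add: cont, simp_all add: even_cubic_def)
  then obtain a where a: "4.009 \<le> a" "a \<le> 5" "even_cubic 0 a = 0" by auto
  have "\<exists>x\<ge>22.67359. x \<le> 23 \<and> even_cubic 0 x = 0"
    by (rule IVT') (simp_all add: cont, simp_all add: even_cubic_def)
  then obtain b where b: "22.67359 \<le> b" "b \<le> 23" "even_cubic 0 b = 0" by auto
  have "\<exists>x\<ge>14.0305. x \<le> 15 \<and> odd_cubic 0 x = 0"
    by (rule IVT') (simp_all add: cont, simp_all add: odd_cubic_def)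
  then obtain c where c: "14.0305 \<le> c" "c \<le> 15" "odd_cubic 0 c = 0" by auto
  have "(303300 :: real) < 4.009 ^ 4 + 22.67359 ^ 4 + 14.0305 ^ 4"
    by (simp add: field_simps)
  also have "\<dots> \<le> a ^ 4 + b ^ 4 + c ^ 4"
    using a b c by (intro add_mono power_mono) auto
  \<comment> \<open>The three enclosing intervals are disjoint, so the set has three distinct
    elements.\<close>
  also have "\<dots> = (\<Sum>x\<in>{a, b, c}. x ^ 4)"
    using a b c by simp
  also have "\<dots> \<le> pos_four_energy J0"
    using a b c poly_char_poly_J[where t = False]
    by (intro pos_four_energy_ge) (auto simp: adj_graph_def J0_def)
  finally show ?thesis .
qed

theorem mainTheorem4:
  "pos_four_energy J1 - pos_four_energy J0 < - (1281106782111 / 500000000000) \<and>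
   - (1281106782111 / 500000000000) < (0 :: real)"
  using pos_four_energy_J0 by (simp add: pos_four_energy_J1)

end
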